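(* Let $H$ and $U$ be complex Hilbert spaces. Assume that $\mathcal{A} : \mathcal{D}(\mathcal{A}) \subset H \to H$ generates a strongly continuous semigroup $\mathcal{S}(t)$ on $H$, has a compact resolvent, and that the system of root vectors of its adjoint $\mathcal{A}^*$ is complete in $H$. Let $\mathcal{C} : \mathcal{D}(\mathcal{C}) \subset H \to U$ be a linear operator that is relatively bounded with respect to $\mathcal{A}$. Then the property $$\forall z_0 \in \mathcal{D}(\mathcal{A}), \quad \Big( \mathcal{C}\mathcal{S}(t) z_0 = 0 \text{ for a.e. } t \in (0,+\infty)\Big) \Longrightarrow z_0 = 0$$ holds if and only if $$\ker(s-\mathcal{A}) \cap \ker \mathcal{C} = \{0\}, \quad \forall s \in \mathbb{C}.$$
   Context: Root vectors of an operator $\mathcal{T}$ are the nonzero vectors of $\bigcup_{k\ge 1}\ker(\mu-\mathcal{T})^k$, for $\mu$ an eigenvalue of $\mathcal{T}$; the system of root vectors is complete in $H$ if its linear span is dense in $H$. The operator $\mathcal{C}$ is relatively bounded with respect to $\mathcal{A}$ if $\mathcal{D}(\mathcal{A})\subset\mathcal{D}(\mathcal{C})$ and there is a constant $c\ge 0$ with $\|\mathcal{C}z\|_U \le c(\|z\|_H+\|\mathcal{A}z\|_H)$ for all $z\in\mathcal{D}(\mathcal{A})$. *)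

theory Defs
  imports "HOL-Analysis.Analysis"
begin

section \<open>Complex Hilbert spaces\<close>

class complex_vector = real_vector +
  fixes scaleC :: "complex \<Rightarrow> 'a \<Rightarrow> 'a" (infixr "*\<^sub>C" 75)
  assumes scaleC_add_right: "a *\<^sub>C (x + y) = a *\<^sub>C x + a *\<^sub>C y"
    and scaleC_add_left: "(a + b) *\<^sub>C x = a *\<^sub>C x + b *\<^sub>C x"
    and scaleC_scaleC: "a *\<^sub>C (b *\<^sub>C x) = (a * b) *\<^sub>C x"
    and scaleC_of_real: "complex_of_real r *\<^sub>C x = r *\<^sub>R x"

text \<open>The inner product is linear in the first argument and antilinear in the second.
  Definiteness and positivity follow from \<open>cinner_self\<close>; completeness comes from \<^class>\<open>banach\<close>.\<close>

class chilbert_space = complex_vector + banach +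
  fixes cinner :: "'a \<Rightarrow> 'a \<Rightarrow> complex"
  assumes cinner_commute: "cinner x y = cnj (cinner y x)"
    and cinner_add_left: "cinner (x + y) z = cinner x z + cinner y z"
    and cinner_scaleC_left: "cinner (a *\<^sub>C x) y = a * cinner x y"
    and cinner_self: "cinner x x = complex_of_real ((norm x)\<^sup>2)"

global_interpretation complex_vector:
  vector_space "scaleC :: complex \<Rightarrow> 'a \<Rightarrow> 'a::complex_vector"
  defines csubspace = complex_vector.subspace
    and cspan = complex_vector.span
proof
  fix a b :: complex and x y :: 'a
  show "a *\<^sub>C (x + y) = a *\<^sub>C x + a *\<^sub>C y" by (rule scaleC_add_right)
  show "(a + b) *\<^sub>C x = a *\<^sub>C x + b *\<^sub>C x" by (rule scaleC_add_left)
  show "a *\<^sub>C b *\<^sub>C x = (a * b) *\<^sub>C x" by (rule scaleC_scaleC)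
  show "1 *\<^sub>C x = x" using scaleC_of_real[of 1 x] by simp
qed

instantiation complex :: chilbert_space
begin

definition scaleC_complex :: "complex \<Rightarrow> complex \<Rightarrow> complex"
  where "scaleC_complex a x = a * x"

definition cinner_complex :: "complex \<Rightarrow> complex \<Rightarrow> complex"
  where "cinner_complex x y = x * cnj y"

instance
proof
  fix x :: complex
  show "cinner x x = complex_of_real ((norm x)\<^sup>2)"
    unfolding cinner_complex_def by (rule complex_norm_square[symmetric])
qed (auto simp: scaleC_complex_def cinner_complex_def algebra_simps scaleR_conv_of_real)

end

definition bounded_clinear :: "('a::chilbert_space \<Rightarrow> 'b::chilbert_space) \<Rightarrow> bool"
  where "bounded_clinear T \<longleftrightarrow> bounded_linear T \<and> (\<forall>a x. T (a *\<^sub>C x) = a *\<^sub>C T x)"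

definition compact_operator :: "('a::chilbert_space \<Rightarrow> 'b::chilbert_space) \<Rightarrow> bool"
  where "compact_operator T \<longleftrightarrow> bounded_clinear T \<and> compact (closure (T ` cball 0 1))"

section \<open>Unbounded operators\<close>

text \<open>The values of \<open>app T\<close> outside \<open>domain T\<close> carry no meaning; no definition below
  depends on them.\<close>

record ('a, 'b) operator =
  "domain" :: "'a set"
  app :: "'a \<Rightarrow> 'b"

definition linear_operator :: "('a::complex_vector, 'b::complex_vector) operator \<Rightarrow> bool"
  where "linear_operator T \<longleftrightarrow> csubspace (domain T) \<and>
    (\<forall>x\<in>domain T. \<forall>y\<in>domain T. app T (x + y) = app T x + app T y) \<and>
    (\<forall>a. \<forall>x\<in>domain T. app T (a *\<^sub>C x) = a *\<^sub>C app T x)"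

definition ker :: "('a, 'b::zero) operator \<Rightarrow> 'a set"
  where "ker T = {x \<in> domain T. app T x = 0}"

text \<open>\<open>shift \<mu> T\<close> is \<open>\<mu> - T\<close>.\<close>

definition shift :: "complex \<Rightarrow> ('a::complex_vector, 'a) operator \<Rightarrow> ('a, 'a) operator"
  where "shift \<mu> T = \<lparr>domain = domain T, app = (\<lambda>x. \<mu> *\<^sub>C x - app T x)\<rparr>"

definition op_comp :: "('b, 'c) operator \<Rightarrow> ('a, 'b) operator \<Rightarrow> ('a, 'c) operator"
  where "op_comp S T = \<lparr>domain = {x \<in> domain T. app T x \<in> domain S}, app = app S \<circ> app T\<rparr>"

primrec op_power :: "('a, 'a) operator \<Rightarrow> nat \<Rightarrow> ('a, 'a) operator"
  where
    "op_power T 0 = \<lparr>domain = UNIV, app = id\<rparr>"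
  | "op_power T (Suc k) = op_comp T (op_power T k)"

definition eigenvalue :: "('a::complex_vector, 'a) operator \<Rightarrow> complex \<Rightarrow> bool"
  where "eigenvalue T \<mu> \<longleftrightarrow> (\<exists>x. x \<noteq> 0 \<and> x \<in> ker (shift \<mu> T))"

definition root_vectors :: "('a::complex_vector, 'a) operator \<Rightarrow> 'a set"
  where "root_vectors T =
    {x. x \<noteq> 0 \<and> (\<exists>\<mu>. eigenvalue T \<mu> \<and> x \<in> (\<Union>k\<in>{1..}. ker (op_power (shift \<mu> T) k)))}"

definition complete_system :: "'a::chilbert_space set \<Rightarrow> bool"
  where "complete_system V \<longleftrightarrow> closure (cspan V) = UNIV"

text \<open>The adjoint is meant for densely defined \<open>T\<close>, for which the vector \<open>w\<close> below is unique.\<close>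

definition adjoint_op ::
    "('a::chilbert_space, 'b::chilbert_space) operator \<Rightarrow> ('b, 'a) operator"
  where "adjoint_op T =
    \<lparr>domain = {y. \<exists>w. \<forall>x\<in>domain T. cinner (app T x) y = cinner x w},
     app = (\<lambda>y. THE w. \<forall>x\<in>domain T. cinner (app T x) y = cinner x w)\<rparr>"

definition resolvent :: "('a::chilbert_space, 'a) operator \<Rightarrow> complex \<Rightarrow> 'a \<Rightarrow> 'a"
  where "resolvent T \<mu> = inv_into (domain T) (app (shift \<mu> T))"

definition resolvent_set :: "('a::chilbert_space, 'a) operator \<Rightarrow> complex set"
  where "resolvent_set T =
    {\<mu>. bij_betw (app (shift \<mu> T)) (domain T) UNIV \<and> bounded_clinear (resolvent T \<mu>)}"

text \<open>By the resolvent identity, compactness at one point of the resolvent set is the same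
  as compactness at all points of a nonempty resolvent set.\<close>

definition has_compact_resolvent :: "('a::chilbert_space, 'a) operator \<Rightarrow> bool"
  where "has_compact_resolvent T \<longleftrightarrow>
    (\<exists>\<mu>\<in>resolvent_set T. compact_operator (resolvent T \<mu>))"

definition relatively_bounded ::
    "('a::chilbert_space, 'c::chilbert_space) operator \<Rightarrow>
     ('a, 'b::chilbert_space) operator \<Rightarrow> bool"
  where "relatively_bounded C A \<longleftrightarrow> domain A \<subseteq> domain C \<and>
    (\<exists>c\<ge>0. \<forall>z\<in>domain A. norm (app C z) \<le> c * (norm z + norm (app A z)))"

section \<open>Strongly continuous semigroups\<close>

text \<open>Only the values \<open>S t\<close> for \<open>t \<ge> 0\<close> are constrained.\<close>

definition C0_semigroup :: "(real \<Rightarrow> 'a::chilbert_space \<Rightarrow> 'a) \<Rightarrow> bool"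
  where "C0_semigroup S \<longleftrightarrow>
    (\<forall>t\<ge>0. bounded_clinear (S t)) \<and>
    (\<forall>x. S 0 x = x) \<and>
    (\<forall>s\<ge>0. \<forall>t\<ge>0. \<forall>x. S (s + t) x = S s (S t x)) \<and>
    (\<forall>x. ((\<lambda>t. S t x) \<longlongrightarrow> x) (at_right 0))"

definition generates ::
    "('a::chilbert_space, 'a) operator \<Rightarrow> (real \<Rightarrow> 'a \<Rightarrow> 'a) \<Rightarrow> bool"
  where "generates A S \<longleftrightarrow> C0_semigroup S \<and>
    domain A = {x. \<exists>y. ((\<lambda>t. (S t x - x) /\<^sub>R t) \<longlongrightarrow> y) (at_right 0)} \<and>
    (\<forall>x\<in>domain A. ((\<lambda>t. (S t x - x) /\<^sub>R t) \<longlongrightarrow> app A x) (at_right 0))"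

end

theory Submission
  imports Defs
begin

text \<open>If \<open>C S(t) z = 0\<close> for all \<open>t\<close>, then \<open>(s - A) z\<close> lies in the closed, semigroup-invariant subspace
  \<open>N\<close> of all \<open>x\<close> with \<open>C (s - A)\<^sup>-\<^sup>1 S(t) x = 0\<close> for all \<open>t \<ge> 0\<close>, where \<open>s\<close> is real and large enough for
  \<open>N\<close> to be invariant under the compact operator \<open>R = (s - A)\<^sup>-\<^sup>1\<close>. An eigenvector of \<open>R\<close> in \<open>N\<close> would
  be an eigenvector of \<open>A\<close> in the kernel of \<open>C\<close>. In its absence the Fredholm alternative on \<open>N\<close> makes
  every \<open>id - c R\<close> map \<open>N\<close> onto \<open>N\<close>, which forces \<open>N\<close> to be orthogonal to the root
  vectors of the adjoint, so \<open>N = 0\<close> by completeness. No spectral projections are needed.\<close>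

section \<open>Bounded operators on Banach and Hilbert spaces\<close>

text \<open>The closed sets \<open>E k\<close>, on which the whole family is bounded by
  \<open>k\<close>, cover the space; by Baire one of them contains a ball, and linearity moves the
  bound to the origin.\<close>

theorem uniform_boundedness_principle:
  fixes F :: "'i \<Rightarrow> 'a::banach \<Rightarrow> 'b::real_normed_vector"
  assumes lin: "\<And>i. i \<in> I \<Longrightarrow> bounded_linear (F i)"
    and bdd: "\<And>x. bounded ((\<lambda>i. F i x) ` I)"
  shows "\<exists>M>0. \<forall>i\<in>I. \<forall>x. norm (F i x) \<le> M * norm x"
proof -
  define E where "E k = {x. \<forall>i\<in>I. norm (F i x) \<le> real k}" for k :: nat
  have closed_E: "closed (E k)" for k
  proof -
    have "E k = (\<Inter>i\<in>I. {x. norm (F i x) \<le> real k})"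
      by (auto simp: E_def)
    moreover have "closed {x. norm (F i x) \<le> real k}" if "i \<in> I" for i
      by (intro closed_Collect_le continuous_intros
          linear_continuous_on[OF lin[OF that]])
    ultimately show ?thesis by auto
  qed
  have "\<exists>k. x \<in> E k" for x
  proof -
    obtain b where "\<And>i. i \<in> I \<Longrightarrow> norm (F i x) \<le> b"
      using bdd[of x] by (auto simp: bounded_iff)
    moreover obtain k where "b \<le> real k" using real_arch_simple by blast
    ultimately show ?thesis unfolding E_def by (auto intro: order_trans)
  qed
  then have E_UN: "\<Union>(range E) = UNIV" by auto
  have "\<exists>k. interior (E k) \<noteq> {}"
  proof (rule ccontr)
    assume "\<not> ?thesis"
    then have "interior (\<Union>(range E)) = {}"
      using Met_TC.metric_Baire_category_alt[of "range E"] closed_E complete_UNIV by auto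
    then show False unfolding E_UN by simp
  qed
  then obtain k where "interior (E k) \<noteq> {}" ..
  then obtain x0 r where r: "r > 0" "ball x0 r \<subseteq> E k"
    by (meson ex_in_conv mem_interior)
  have near: "norm (F i y) \<le> 2 * real k" if "i \<in> I" "norm y < r" for i y
  proof -
    have "x0 \<in> E k" "x0 + y \<in> E k"
      using r that by (auto simp: dist_norm subset_iff)
    then have "norm (F i x0) \<le> k" "norm (F i (x0 + y)) \<le> k"
      using that by (auto simp: E_def)
    moreover have "F i y = F i (x0 + y) - F i x0"
      using lin[OF that(1)] by (simp add: linear_simps)
    ultimately show ?thesis
      using norm_triangle_ineq4[of "F i (x0 + y)" "F i x0"] by simp
  qed
  \<comment> \<open>Rescaling \<open>x\<close> to norm \<open>r / 2\<close> turns the bound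
    \<open>2 * k\<close> near 0 into \<open>4 * k / r\<close>; the \<open>+ 1\<close> keeps the
    constant positive when \<open>k = 0\<close>.\<close>
  have "norm (F i x) \<le> (4 * real k / r + 1) * norm x" if "i \<in> I" for i x
  proof (cases "x = 0")
    case True
    then show ?thesis using lin[OF that] by (simp add: linear_simps)
  next
    case False
    define c where "c = r / (2 * norm x)"
    have c: "c > 0" using r False by (simp add: c_def)
    have "norm (c *\<^sub>R x) < r" using False r by (simp add: c_def)
    then have "c * norm (F i x) \<le> 2 * real k"
      using near[OF that, of "c *\<^sub>R x"] lin[OF that] c by (simp add: linear_simps)
    then have "norm (F i x) \<le> 2 * real k / c" using c by (simp add: field_simps)
    also have "\<dots> = (4 * real k / r) * norm x" using False r by (simp add: c_def field_simps)
    also have "\<dots> \<le> (4 * real k / r + 1) * norm x" by (simp add: algebra_simps)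
    finally show ?thesis .
  qed
  moreover have "4 * real k / r + 1 > 0" using r by (simp add: add_nonneg_pos)
  ultimately show ?thesis by blast
qed

section \<open>Riesz lemma and Fredholm alternative\<close>

text \<open>Normalise \<open>u - v\<close>, where \<open>v\<close> in \<open>Y\<close> is less than
  twice as far from \<open>u\<close> as the distance \<open>d\<close>. Translating and scaling
  inside \<open>Y\<close> reduces the claim to \<open>d / n > 1/2\<close>.\<close>

lemma Riesz_lemma:
  fixes X Y :: "'a::real_normed_vector set"
  assumes "subspace X" "subspace Y" "closed Y" "Y \<subset> X"
  obtains x where "x \<in> X" "norm x = 1" "\<And>y. y \<in> Y \<Longrightarrow> norm (x - y) \<ge> 1/2"
proof -
  obtain u where u: "u \<in> X" "u \<notin> Y" using assms by auto
  define d where "d = infdist u Y"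
  have ne: "Y \<noteq> {}" using assms(2) subspace_0 by auto
  have d: "d > 0"
    unfolding d_def using infdist_pos_not_in_closed[OF assms(3) ne u(2)] .
  have "\<exists>v\<in>Y. dist u v < 2 * d"
  proof (rule ccontr)
    assume "\<not> ?thesis"
    then have "2 * d \<le> infdist u Y"
      unfolding infdist_notempty[OF ne] by (intro cINF_greatest[OF ne]) (auto simp: not_less)
    then show False using d by (simp add: d_def)
  qed
  then obtain v where v: "v \<in> Y" "norm (u - v) < 2 * d" by (auto simp: dist_norm)
  define n where "n = norm (u - v)"
  have n: "n > 0" using u v by (auto simp: n_def)
  define x where "x = (u - v) /\<^sub>R n"
  show ?thesis
  proof
    show "x \<in> X" unfolding x_def using assms u v by (auto intro: subspace_diff subspace_scale)
    show "norm x = 1" using n by (simp add: x_def) (simp add: n_def)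
    fix y assume "y \<in> Y"
    then have "v + n *\<^sub>R y \<in> Y" using assms v by (auto intro: subspace_add subspace_scale)
    then have "d \<le> norm (u - (v + n *\<^sub>R y))"
      unfolding d_def using infdist_le[of _ Y u] by (auto simp: dist_norm)
    also have "u - (v + n *\<^sub>R y) = n *\<^sub>R (x - y)" using n by (simp add: x_def algebra_simps)
    finally have "d \<le> n * norm (x - y)" using n by simp
    moreover have "n < 2 * d" using v by (simp add: n_def)
    ultimately have "n < n * (2 * norm (x - y))" by simp
    then show "1/2 \<le> norm (x - y)" using n by simp
  qed
qed

text \<open>Riesz's argument: if \<open>L = id - K\<close> were injective but not surjective on \<open>N\<close>, then
  \<open>L\<^sup>k N\<close> would be a strictly decreasing chain of closed subspaces, and almost orthogonal unit
  vectors in it would contradict compactness of \<open>K\<close>.\<close>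

theorem Fredholm_alternative_on_closed_subspace:
  fixes K :: "'a::banach \<Rightarrow> 'a"
  assumes K: "bounded_linear K"
    and compact: "\<And>x :: nat \<Rightarrow> 'a. bounded (range x) \<Longrightarrow>
      \<exists>l r. strict_mono r \<and> (\<lambda>n. K (x (r n))) \<longlonglongrightarrow> l"
    and N: "subspace N" "closed N" "K ` N \<subseteq> N"
    and inj: "\<And>x. x \<in> N \<Longrightarrow> K x = x \<Longrightarrow> x = 0"
  shows "(\<lambda>x. x - K x) ` N = N"
proof -
  define L where "L x = x - K x" for x
  have L: "bounded_linear L"
    unfolding L_def by (intro bounded_linear_sub bounded_linear_ident K)
  have L_N: "L x \<in> N" if "x \<in> N" for x
    using that N by (auto simp: L_def intro: subspace_diff)
  \<comment> \<open>Otherwise there are unit vectors with \<open>L (x n)\<close> tending to 0. Since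
    \<open>x n = L (x n) + K (x n)\<close>, a subsequence converges to a unit fixed point of
    \<open>K\<close> in \<open>N\<close>, against \<open>inj\<close>. The lower bound makes
    \<open>L\<close> map closed subspaces of \<open>N\<close> to closed ones.\<close>
  have "\<exists>c>0. \<forall>x\<in>N. norm (L x) \<ge> c * norm x"
  proof (rule ccontr)
    assume no: "\<not> ?thesis"
    have "\<exists>x. x \<in> N \<and> norm x = 1 \<and> norm (L x) < 1 / real (Suc n)" for n
    proof -
      obtain y where y: "y \<in> N" "norm (L y) < 1 / real (Suc n) * norm y"
        using no by (force simp: not_le dest!: spec[of _ "1 / real (Suc n)"])
      then have "y \<noteq> 0" using L by (auto simp: linear_simps)
      then show ?thesis
        using y L N by (intro exI[of _ "y /\<^sub>R norm y"])
          (auto simp: linear_simps field_simps intro: subspace_scale)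
    qed
    then obtain x where x: "\<And>n. x n \<in> N" "\<And>n. norm (x n) = 1"
        "\<And>n. norm (L (x n)) < 1 / real (Suc n)" by metis
    have "bounded (range x)" using x(2) by (auto simp: bounded_iff intro!: exI[of _ 1])
    then obtain l r where r: "strict_mono r" "(\<lambda>n. K (x (r n))) \<longlonglongrightarrow> l"
      using compact by blast
    have "(\<lambda>n. L (x n)) \<longlonglongrightarrow> 0"
      using x(3) by (intro LIMSEQ_norm_0) auto
    then have "(\<lambda>n. L (x (r n))) \<longlonglongrightarrow> 0"
      using LIMSEQ_subseq_LIMSEQ[OF _ r(1)] by (auto simp: o_def)
    from tendsto_add[OF this r(2)] have lim: "(\<lambda>n. x (r n)) \<longlonglongrightarrow> l"
      by (simp add: L_def)
    have "l \<in> N" using closed_sequentially[OF N(2) _ lim] x by auto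
    moreover have "K l = l"
      using bounded_linear.tendsto[OF K lim] r(2) LIMSEQ_unique by blast
    ultimately have "l = 0" using inj by blast
    moreover have "norm l = 1"
      using tendsto_norm[OF lim] x(2) LIMSEQ_unique[of "\<lambda>n. 1::real" 1] by auto
    ultimately show False by simp
  qed
  then obtain c where c: "c > 0" "\<And>x. x \<in> N \<Longrightarrow> norm (L x) \<ge> c * norm x" by blast
  have L_eq: "x = y" if "x \<in> N" "y \<in> N" "L x = L y" for x y
  proof -
    have "K (x - y) = x - y"
      using that K by (simp add: L_def linear_simps algebra_simps)
    then have "x - y = 0" using inj that N by (metis subspace_diff)
    then show ?thesis by simp
  qed
  have image_closed: "subspace (L ` Y) \<and> closed (L ` Y) \<and> L ` Y \<subseteq> N"
    if "subspace Y" "closed Y" "Y \<subseteq> N" for Y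
  proof -
    have "complete (L ` Y)"
      using that c by (intro complete_isometric_image[OF c(1) _ L]) (auto simp: complete_eq_closed)
    then show ?thesis
      using that L_N linear_subspace_image[OF bounded_linear.linear[OF L]]
      by (auto simp: complete_eq_closed)
  qed
  define Y where "Y k = (image L ^^ k) N" for k
  have Y_Suc: "Y (Suc k) = L ` Y k" for k by (simp add: Y_def)
  have Y: "subspace (Y k) \<and> closed (Y k) \<and> Y k \<subseteq> N" for k
  proof (induction k)
    case 0
    then show ?case using N by (simp add: Y_def)
  next
    case (Suc k)
    then show ?case unfolding Y_Suc using image_closed by blast
  qed
  have Y_decr: "Y (Suc k) \<subseteq> Y k" for k
  proof (induction k)
    case 0
    then show ?case using L_N by (auto simp: Y_def)
  next
    case (Suc k)
    then show ?case unfolding Y_Suc by blast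
  qed
  then have Y_mono: "Y m \<subseteq> Y k" if "k \<le> m" for k m
    using that lift_Suc_antimono_le[of Y] by blast
  have "L ` N = N"
  proof (rule ccontr)
    assume ne: "L ` N \<noteq> N"
    \<comment> \<open>Injectivity of \<open>L\<close> on \<open>N\<close> carries the strictness of
      the first inclusion down the chain.\<close>
    have strict: "Y (Suc k) \<subset> Y k" for k
    proof (induction k)
      case 0
      then show ?case using ne Y_decr[of 0] by (auto simp: Y_def)
    next
      case (Suc k)
      then obtain y where y: "y \<in> Y k" "y \<notin> Y (Suc k)" by auto
      have "L y \<notin> Y (Suc (Suc k))"
      proof
        assume "L y \<in> Y (Suc (Suc k))"
        then obtain y' where "y' \<in> Y (Suc k)" "L y = L y'" unfolding Y_Suc[of "Suc k"] by auto
        then show False using y L_eq[of y y'] Y by blast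
      qed
      moreover have "L y \<in> Y (Suc k)" using y Y_Suc by auto
      ultimately show ?case using Y_decr by blast
    qed
    have "\<exists>x. x \<in> Y k \<and> norm x = 1 \<and> (\<forall>y\<in>Y (Suc k). norm (x - y) \<ge> 1/2)" for k
      using Riesz_lemma[OF _ _ _ strict[of k]] Y by metis
    then obtain x where x: "\<And>k. x k \<in> Y k" "\<And>k. norm (x k) = 1"
        "\<And>k y. y \<in> Y (Suc k) \<Longrightarrow> norm (x k - y) \<ge> 1/2" by metis
    \<comment> \<open>\<open>K (x k) - K (x m)\<close> is \<open>x k\<close> minus
      \<open>L (x k) + (x m - L (x m))\<close>, and the latter vector lies in
      \<open>Y (Suc k)\<close>.\<close>
    have sep: "norm (K (x k) - K (x m)) \<ge> 1/2" if "k < m" for k m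
    proof -
      have "L (x k) \<in> Y (Suc k)" "L (x m) \<in> Y (Suc k)" "x m \<in> Y (Suc k)"
        using x(1) Y_Suc Y_mono[of "Suc k" m] Y_mono[of "Suc k" "Suc m"] that by auto
      then have "L (x k) + (x m - L (x m)) \<in> Y (Suc k)"
        using Y by (auto intro!: subspace_add subspace_diff)
      from x(3)[OF this] show ?thesis by (simp add: L_def algebra_simps)
    qed
    have "bounded (range x)" using x(2) by (auto simp: bounded_iff intro!: exI[of _ 1])
    then obtain l r where r: "strict_mono r" "(\<lambda>n. K (x (r n))) \<longlonglongrightarrow> l"
      using compact by blast
    then have "Cauchy (\<lambda>n. K (x (r n)))" using LIMSEQ_imp_Cauchy by blast
    then obtain n0 where "\<And>m n. m \<ge> n0 \<Longrightarrow> n \<ge> n0 \<Longrightarrow> norm (K (x (r m)) - K (x (r n))) < 1/2"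
      unfolding Cauchy_iff by (metis half_gt_zero_iff zero_less_one)
    then have "norm (K (x (r n0)) - K (x (r (Suc n0)))) < 1/2" by simp
    moreover have "r n0 < r (Suc n0)" using r by (simp add: strict_mono_def)
    ultimately show False using sep by fastforce
  qed
  then show ?thesis by (simp add: L_def)
qed

section \<open>Complex inner products and norms\<close>

lemma cinner_scaleC_right: "cinner x (a *\<^sub>C y) = cnj a * cinner x y"
  by (metis cinner_commute cinner_scaleC_left complex_cnj_mult)

lemma cinner_add_right: "cinner x (y + z) = cinner x y + cinner x z"
  by (metis cinner_add_left cinner_commute complex_cnj_add)

lemma cinner_diff_left: "cinner (x - y) z = cinner x z - cinner y z"
  using cinner_add_left[of "x - y" y z] by simp

lemma cinner_diff_right: "cinner x (y - z) = cinner x y - cinner x z"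
  using cinner_add_right[of x "y - z" z] by simp

lemma cinner_zero_right [simp]: "cinner x 0 = 0"
  using cinner_diff_right[of x 0 0] by simp

text \<open>The class links the norm to complex scalars only through the inner product, so
  homogeneity is read off from \<open>cinner_self\<close>.\<close>

lemma norm_scaleC: "norm (a *\<^sub>C x) = cmod a * norm (x :: 'a::chilbert_space)"
proof -
  have "complex_of_real ((norm (a *\<^sub>C x))\<^sup>2) = a * cnj a * complex_of_real ((norm x)\<^sup>2)"
    unfolding cinner_self[symmetric] cinner_scaleC_left cinner_scaleC_right
    by (simp add: cinner_self)
  also have "\<dots> = complex_of_real ((cmod a * norm x)\<^sup>2)"
    by (simp only: complex_norm_square[symmetric] power_mult_distrib of_real_mult)
  finally have "(norm (a *\<^sub>C x))\<^sup>2 = (cmod a * norm x)\<^sup>2"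
    using of_real_eq_iff by blast
  then show ?thesis by (simp add: power2_eq_iff_nonneg)
qed

lemma bounded_bilinear_scaleC:
  "bounded_bilinear (scaleC :: complex \<Rightarrow> 'a::chilbert_space \<Rightarrow> 'a)"
proof
  fix a b :: complex and r :: real and x y :: 'a
  show "(a + b) *\<^sub>C x = a *\<^sub>C x + b *\<^sub>C x" by (rule scaleC_add_left)
  show "a *\<^sub>C (x + y) = a *\<^sub>C x + a *\<^sub>C y" by (rule scaleC_add_right)
  show "(r *\<^sub>R a) *\<^sub>C x = r *\<^sub>R a *\<^sub>C x"
    by (metis scaleC_of_real scaleC_scaleC scaleR_conv_of_real)
  show "a *\<^sub>C r *\<^sub>R x = r *\<^sub>R a *\<^sub>C x"
    by (metis scaleC_of_real scaleC_scaleC mult.commute)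
  show "\<exists>K. \<forall>a x. norm (a *\<^sub>C (x::'a)) \<le> norm a * norm x * K"
    by (intro exI[of _ 1]) (simp add: norm_scaleC)
qed

lemmas bounded_linear_scaleC_right = bounded_bilinear.bounded_linear_right[OF bounded_bilinear_scaleC]
lemmas continuous_on_scaleC = bounded_bilinear.continuous_on[OF bounded_bilinear_scaleC]

lemma csubspace_imp_subspace: "csubspace V \<Longrightarrow> subspace V"
  unfolding subspace_def complex_vector.subspace_def by (metis scaleC_of_real)

lemma bounded_clinear_compose:
  "bounded_clinear f \<Longrightarrow> bounded_clinear g \<Longrightarrow> bounded_clinear (\<lambda>x. f (g x))"
  unfolding bounded_clinear_def by (auto intro: bounded_linear_compose)

text \<open>Pythagoras replaces the continuity of the inner product here.\<close>

lemma orthogonal_to_dense: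
  fixes z :: "'a::chilbert_space"
  assumes "closure V = UNIV" and orth: "\<And>u. u \<in> V \<Longrightarrow> cinner u z = 0"
  shows "z = 0"
proof (rule ccontr)
  assume "z \<noteq> 0"
  have "z \<in> closure V" using assms by simp
  then obtain u where u: "u \<in> V" "norm (u - z) < norm z"
    using \<open>z \<noteq> 0\<close> unfolding closure_approachable dist_norm by (metis zero_less_norm_iff)
  have "cinner z u = 0" using orth[OF u(1)] by (subst cinner_commute) simp
  then have "complex_of_real ((norm (u - z))\<^sup>2) = complex_of_real ((norm u)\<^sup>2 + (norm z)\<^sup>2)"
    unfolding of_real_add cinner_self[symmetric]
    by (simp add: cinner_diff_left cinner_diff_right orth[OF u(1)])
  then have "(norm (u - z))\<^sup>2 = (norm u)\<^sup>2 + (norm z)\<^sup>2"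
    using of_real_eq_iff by blast
  then have "(norm z)\<^sup>2 \<le> (norm (u - z))\<^sup>2" by simp
  then show False using u(2) by (simp add: power2_le_iff_abs_le)
qed

section \<open>Operator powers, compactness and one-sided derivatives\<close>

text \<open>Splits off the factor applied first, whereas the definition splits off the last. This is
  what lets one application of \<open>\<mu> - A*\<close> lower the order of a root vector.\<close>

lemma op_power_Suc_right: "op_power T (Suc k) = op_comp (op_power T k) T"
proof (induction k)
  case 0
  then show ?case by (simp add: op_comp_def)
next
  case (Suc k)
  have "op_comp T (op_comp (op_power T k) T) = op_comp (op_comp T (op_power T k)) T"
    by (auto simp: op_comp_def)
  then show ?case using Suc by simp
qed

lemma compact_operator_convergent_subsequence:
  assumes "compact_operator T" "bounded (range x)"
  obtains l r where "strict_mono (r :: nat \<Rightarrow> nat)" "(\<lambda>n. T (x (r n))) \<longlonglongrightarrow> l"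
proof -
  obtain b where b: "b > 0" "\<And>n. norm (x n) \<le> b"
    using assms(2) by (auto simp: bounded_pos)
  have T: "bounded_linear T" using assms(1) by (simp add: compact_operator_def bounded_clinear_def)
  have "seq_compact (closure (T ` cball 0 1))"
    using assms(1) by (simp add: compact_operator_def compact_imp_seq_compact)
  moreover have "\<forall>n. T (x n /\<^sub>R b) \<in> closure (T ` cball 0 1)"
    using b by (auto simp: field_simps intro!: subsetD[OF closure_subset])
  ultimately obtain l r where r: "strict_mono (r :: nat \<Rightarrow> nat)"
      "((\<lambda>n. T (x n /\<^sub>R b)) \<circ> r) \<longlonglongrightarrow> l"
    by (rule seq_compactE)
  have "(\<lambda>n. b *\<^sub>R T (x (r n) /\<^sub>R b)) \<longlonglongrightarrow> b *\<^sub>R l"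
    using tendsto_scaleR[OF tendsto_const r(2)] by (simp add: o_def)
  then have "(\<lambda>n. T (x (r n))) \<longlonglongrightarrow> b *\<^sub>R l"
    using T b by (simp add: linear_simps)
  with r(1) show ?thesis by (rule that)
qed

text \<open>Passes from derivatives on an interval, for which calculus rules are available, to the
  right-hand quotients that define the generator.\<close>

lemma has_vector_derivative_imp_right_quotient_tendsto:
  assumes "(f has_vector_derivative d) (at 0 within {0..1})"
  shows "((\<lambda>t. (f t - f 0) /\<^sub>R t) \<longlongrightarrow> d) (at_right 0)"
proof -
  have "((\<lambda>t. (f t - f 0 - t *\<^sub>R d) /\<^sub>R \<bar>t\<bar>) \<longlongrightarrow> 0) (at_right 0)"
    using assms by (simp add: has_vector_derivative_def has_derivative_at_within at_within_Icc_at_right)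
  moreover have "\<forall>\<^sub>F t in at_right 0. (f t - f 0 - t *\<^sub>R d) /\<^sub>R \<bar>t\<bar> = (f t - f 0) /\<^sub>R t - d"
    by (auto simp: eventually_at_right_field algebra_simps intro!: exI[of _ 1])
  ultimately have "((\<lambda>t. (f t - f 0) /\<^sub>R t - d) \<longlongrightarrow> 0) (at_right 0)"
    by (rule Lim_transform_eventually)
  then show ?thesis by (rule LIM_zero_cancel)
qed

section \<open>Generators of strongly continuous semigroups\<close>

locale generator =
  fixes A :: "('h::chilbert_space, 'h) operator" and S :: "real \<Rightarrow> 'h \<Rightarrow> 'h"
  assumes generates: "generates A S"
begin

section \<open>Local boundedness and continuity of orbits\<close>

lemma bounded_clinear_S: "t \<ge> 0 \<Longrightarrow> bounded_clinear (S t)"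
  and S_0: "S 0 x = x"
  and S_add: "s \<ge> 0 \<Longrightarrow> t \<ge> 0 \<Longrightarrow> S (s + t) x = S s (S t x)"
  and S_tendsto: "((\<lambda>t. S t x) \<longlongrightarrow> x) (at_right 0)"
  using generates by (auto simp: generates_def C0_semigroup_def)

lemma bounded_linear_S: "t \<ge> 0 \<Longrightarrow> bounded_linear (S t)"
  and S_scaleC: "t \<ge> 0 \<Longrightarrow> S t (a *\<^sub>C x) = a *\<^sub>C S t x"
  using bounded_clinear_S by (auto simp: bounded_clinear_def)

lemma S_commute: "s \<ge> 0 \<Longrightarrow> t \<ge> 0 \<Longrightarrow> S s (S t x) = S t (S s x)"
  by (metis S_add add.commute)

lemma S_near_0:
  assumes "e > 0"
  shows "\<exists>d>0. \<forall>t. 0 \<le> t \<and> t < d \<longrightarrow> norm (S t x - x) < e"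
proof -
  have "\<forall>\<^sub>F t in at_right 0. dist (S t x) x < e"
    using S_tendsto assms by (rule tendstoD)
  then obtain d where d: "d > 0" "\<And>t. 0 < t \<Longrightarrow> t < d \<Longrightarrow> norm (S t x - x) < e"
    unfolding eventually_at_right_field dist_norm by auto
  have "norm (S t x - x) < e" if "0 \<le> t" "t < d" for t
    using d(2)[of t] that assms S_0 by (cases "t = 0") auto
  with d(1) show ?thesis by blast
qed

text \<open>Otherwise times \<open>t n\<close> tend to 0 along which the operator norms are
  unbounded; but \<open>S (t n) y\<close> converges for every \<open>y\<close>, so uniform
  boundedness applies.\<close>

lemma S_bounded_near_0:
  "\<exists>d>0. \<exists>M>0. \<forall>t x. 0 \<le> t \<and> t \<le> d \<longrightarrow> norm (S t x) \<le> M * norm x"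
proof (rule ccontr)
  assume no: "\<not> ?thesis"
  have "\<exists>t x. 0 \<le> t \<and> t \<le> 1 / real (Suc n) \<and> norm (S t x) > real (Suc n) * norm x" for n
  proof (rule ccontr)
    assume "\<not> ?thesis"
    then have "\<forall>t x. 0 \<le> t \<and> t \<le> 1 / real (Suc n) \<longrightarrow> norm (S t x) \<le> real (Suc n) * norm x"
      by (meson not_less)
    moreover have "1 / real (Suc n) > 0" "real (Suc n) > 0" by simp_all
    ultimately show False using no by blast
  qed
  then obtain t x where t: "\<And>n. 0 \<le> t n" "\<And>n. t n \<le> 1 / real (Suc n)"
      and x: "\<And>n. norm (S (t n) (x n)) > real (Suc n) * norm (x n)" by metis
  have "bounded (range (\<lambda>n. S (t n) y))" for y
  proof (rule convergent_imp_bounded)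
    show "(\<lambda>n. S (t n) y) \<longlonglongrightarrow> y"
    proof (rule LIMSEQ_I)
      fix e :: real assume "e > 0"
      then obtain d where d: "d > 0" "\<And>t. 0 \<le> t \<Longrightarrow> t < d \<Longrightarrow> norm (S t y - y) < e"
        using S_near_0 by blast
      obtain n0 where n0: "1 / real (Suc n0) < d"
        using reals_Archimedean[OF d(1)] by (auto simp: inverse_eq_divide)
      have "norm (S (t n) y - y) < e" if "n \<ge> n0" for n
      proof (rule d(2)[OF t(1)])
        have "1 / real (Suc n) \<le> 1 / real (Suc n0)" using that by (simp add: frac_le)
        then show "t n < d" using t(2)[of n] n0 by linarith
      qed
      then show "\<exists>n0. \<forall>n\<ge>n0. norm (S (t n) y - y) < e" by blast
    qed
  qed
  then obtain M where M: "M > 0" "\<And>n y. norm (S (t n) y) \<le> M * norm y"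
    using uniform_boundedness_principle[of UNIV "\<lambda>n. S (t n)", OF bounded_linear_S[OF t(1)]] by blast
  obtain n where "M \<le> real n" using real_arch_simple by blast
  then have "M * norm (x n) \<le> real (Suc n) * norm (x n)" by (intro mult_right_mono) auto
  then show False using M(2)[of n "x n"] x[of n] by linarith
qed

text \<open>With \<open>r\<close> the smaller of two times and \<open>h\<close> their gap, the
  difference is \<open>S r (S h x - x)\<close> up to sign. It remains to bound \<open>S r\<close>
  uniformly: by \<open>K\<close> if \<open>r = t\<close>, and by \<open>L * M\<close> if
  \<open>r\<close> lies just to the left of \<open>t\<close>.\<close>

lemma orbit_continuous: "continuous_on {0..} (\<lambda>t. S t x)"
  unfolding continuous_on_iff
proof (intro ballI allI impI)
  fix t e :: real assume t: "t \<in> {0..}" and e: "e > 0"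
  obtain d M where M: "d > 0" "M > 0" "\<And>t x. 0 \<le> t \<Longrightarrow> t \<le> d \<Longrightarrow> norm (S t x) \<le> M * norm x"
    using S_bounded_near_0 by blast
  \<comment> \<open>Length of the window to the left of \<open>t\<close>: within \<open>d\<close>
    for the local bound, within \<open>t\<close> so that \<open>S (t - a)\<close> is
    available.\<close>
  define a where "a = min d t"
  have a: "0 \<le> a" "a \<le> d" "a \<le> t" using M t by (auto simp: a_def)
  obtain K where K: "K > 0" "\<And>x. norm (S t x) \<le> K * norm x"
    using bounded_linear.pos_bounded[OF bounded_linear_S[of t]] t by (auto simp: mult.commute)
  obtain L where L: "L > 0" "\<And>x. norm (S (t - a) x) \<le> L * norm x"
    using bounded_linear.pos_bounded[OF bounded_linear_S[of "t - a"]] a by (auto simp: mult.commute)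
  define R where "R = max K (L * M)"
  have R: "R > 0" using K by (simp add: R_def)
  have step: "norm (S r (S h x - x)) \<le> R * norm (S h x - x)"
    if r: "r = t \<or> (r \<le> t \<and> t - a \<le> r)" for r h
  proof (cases "r = t")
    case True
    then show ?thesis
      using K(2)[of "S h x - x"] mult_right_mono[of K R "norm (S h x - x)"] by (simp add: R_def)
  next
    case False
    then have "S r (S h x - x) = S (t - a) (S (r - (t - a)) (S h x - x))"
      using r a S_add[of "t - a" "r - (t - a)"] by simp
    also have "norm \<dots> \<le> L * norm (S (r - (t - a)) (S h x - x))" by (rule L(2))
    also have "\<dots> \<le> L * (M * norm (S h x - x))"
      using r False a L(1) by (intro mult_left_mono M(3)) auto
    also have "\<dots> \<le> R * norm (S h x - x)"
      unfolding mult.assoc[symmetric] by (intro mult_right_mono) (auto simp: R_def)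
    finally show ?thesis .
  qed
  obtain h0 where h0: "h0 > 0" "\<And>h. 0 \<le> h \<Longrightarrow> h < h0 \<Longrightarrow> norm (S h x - x) < e / R"
    using S_near_0[of "e / R" x] e R by (metis divide_pos_pos)
  \<comment> \<open>At \<open>t = 0\<close> the window is degenerate, but no time lies to the left,
    so only \<open>h0\<close> restricts.\<close>
  define h1 where "h1 = (if t = 0 then h0 else min h0 a)"
  have "h1 > 0" using h0 M t by (auto simp: h1_def a_def)
  moreover have "dist (S t' x) (S t x) < e" if t': "t' \<ge> 0" "dist t' t < h1" for t'
  proof -
    define r where "r = min t t'"
    define h where "h = \<bar>t' - t\<bar>"
    have h: "0 \<le> h" "h < h0" using t' by (auto simp: h_def h1_def dist_real_def split: if_splits)
    have r: "r = t \<or> (r \<le> t \<and> t - a \<le> r)" "0 \<le> r"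
      using t t' by (auto simp: r_def h1_def dist_real_def split: if_splits)
    have "dist (S t' x) (S t x) = norm (S (r + h) x - S r x)"
      by (auto simp: r_def h_def dist_norm norm_minus_commute min_def)
    also have "\<dots> = norm (S r (S h x - x))"
      using r h S_add[of r h x] bounded_linear_S[of r] by (simp add: linear_simps)
    also have "\<dots> \<le> R * norm (S h x - x)" using step r by blast
    also have "\<dots> < e" using h0(2)[OF h] R by (simp add: field_simps)
    finally show ?thesis .
  qed
  ultimately show "\<exists>d>0. \<forall>t'\<in>{0..}. dist t' t < d \<longrightarrow> dist (S t' x) (S t x) < e"
    by (intro exI[of _ h1]) auto
qed

lemma S_locally_bounded:
  "\<exists>M>0. \<forall>t\<in>{0..b}. \<forall>x. norm (S t x) \<le> M * norm x"
proof -
  have "bounded ((\<lambda>t. S t x) ` {0..b})" for x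
    by (intro compact_imp_bounded compact_continuous_image
        continuous_on_subset[OF orbit_continuous]) auto
  moreover have "bounded_linear (S t)" if "t \<in> {0..b}" for t
    using that bounded_linear_S by simp
  ultimately show ?thesis by (intro uniform_boundedness_principle)
qed

section \<open>The generator as a linear operator\<close>

lemma domainI:
  assumes "((\<lambda>t. (S t x - x) /\<^sub>R t) \<longlongrightarrow> y) (at_right 0)"
  shows "x \<in> domain A" "app A x = y"
proof -
  show x: "x \<in> domain A" using generates assms by (auto simp: generates_def)
  have "((\<lambda>t. (S t x - x) /\<^sub>R t) \<longlongrightarrow> app A x) (at_right 0)"
    using generates x by (simp add: generates_def)
  then show "app A x = y"
    by (rule tendsto_unique[OF trivial_limit_at_right_real _ assms])
qed

lemma domainD:
  "x \<in> domain A \<Longrightarrow> ((\<lambda>t. (S t x - x) /\<^sub>R t) \<longlongrightarrow> app A x) (at_right 0)"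
  using generates by (auto simp: generates_def)

text \<open>Apply \<open>P\<close> to the difference quotient. This serves for scalar multiples,
  truncated Laplace transforms and the semigroup itself.\<close>

lemma bounded_operator_commutes:
  assumes P: "bounded_linear P" "\<And>t x. t \<ge> 0 \<Longrightarrow> P (S t x) = S t (P x)" and x: "x \<in> domain A"
  shows "P x \<in> domain A" "app A (P x) = P (app A x)"
proof -
  have "((\<lambda>t. P ((S t x - x) /\<^sub>R t)) \<longlongrightarrow> P (app A x)) (at_right 0)"
    by (rule bounded_linear.tendsto[OF P(1) domainD[OF x]])
  moreover have "\<forall>\<^sub>F t in at_right 0. P ((S t x - x) /\<^sub>R t) = (S t (P x) - P x) /\<^sub>R t"
    using P by (auto simp: eventually_at_right_field linear_simps intro!: exI[of _ 1])
  ultimately have "((\<lambda>t. (S t (P x) - P x) /\<^sub>R t) \<longlongrightarrow> P (app A x)) (at_right 0)"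
    by (rule Lim_transform_eventually)
  then show "P x \<in> domain A" "app A (P x) = P (app A x)" using domainI by blast+
qed

lemma A_add:
  assumes "x \<in> domain A" "y \<in> domain A"
  shows "x + y \<in> domain A" "app A (x + y) = app A x + app A y"
proof -
  have "((\<lambda>t. (S t x - x) /\<^sub>R t + (S t y - y) /\<^sub>R t) \<longlongrightarrow> app A x + app A y) (at_right 0)"
    by (intro tendsto_add domainD assms)
  moreover have "\<forall>\<^sub>F t in at_right 0. (S t x - x) /\<^sub>R t + (S t y - y) /\<^sub>R t =
      (S t (x + y) - (x + y)) /\<^sub>R t"
    using bounded_linear_S
    by (auto simp: eventually_at_right_field linear_simps algebra_simps intro!: exI[of _ 1])
  ultimately have "((\<lambda>t. (S t (x + y) - (x + y)) /\<^sub>R t) \<longlongrightarrow> app A x + app A y) (at_right 0)"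
    by (rule Lim_transform_eventually)
  then show "x + y \<in> domain A" "app A (x + y) = app A x + app A y" using domainI by blast+
qed

lemma A_scaleC:
  assumes "x \<in> domain A"
  shows "a *\<^sub>C x \<in> domain A" "app A (a *\<^sub>C x) = a *\<^sub>C app A x"
  using bounded_operator_commutes[OF bounded_linear_scaleC_right _ assms] S_scaleC by auto

lemma linear_operator_A: "linear_operator A"
proof -
  have "0 \<in> domain A"
    by (rule domainI[of _ 0], rule Lim_transform_eventually[OF tendsto_const])
      (use bounded_linear_S in
        \<open>auto simp: eventually_at_right_field linear_simps intro!: exI[of _ 1]\<close>)
  then show ?thesis
    using A_add A_scaleC unfolding linear_operator_def complex_vector.subspace_def by auto
qed

section \<open>Truncated Laplace transforms\<close>

text \<open>The Laplace transform of the orbit cut off at time \<open>\<tau>\<close>: a continuous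
  integrand on a compact interval, for every complex \<open>s\<close>. The value
  \<open>s = 0\<close> gives plain time integrals.\<close>

definition laplace :: "complex \<Rightarrow> real \<Rightarrow> 'h \<Rightarrow> 'h"
  where "laplace s \<tau> x = integral {0..\<tau>} (\<lambda>t. exp (- (s * of_real t)) *\<^sub>C S t x)"

lemma continuous_on_weighted_orbit:
  "continuous_on {0..} (\<lambda>t. exp (- (s * of_real t)) *\<^sub>C S t x)"
  by (intro continuous_on_scaleC orbit_continuous continuous_intros)

lemma weighted_orbit_integrable:
  "0 \<le> a \<Longrightarrow> (\<lambda>t. exp (- (s * of_real t)) *\<^sub>C S t x) integrable_on {a..b}"
  by (intro integrable_continuous_real continuous_on_subset[OF continuous_on_weighted_orbit]) auto

lemma bounded_clinear_laplace: 
  assumes "\<tau> \<ge> 0"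
  shows "bounded_clinear (laplace s \<tau>)"
proof -
  obtain M where M: "M > 0" "\<And>t x. 0 \<le> t \<Longrightarrow> t \<le> \<tau> \<Longrightarrow> norm (S t x) \<le> M * norm x"
    using S_locally_bounded[of \<tau>] by (metis atLeastAtMost_iff)
  have scale: "laplace s \<tau> (a *\<^sub>C x) = a *\<^sub>C laplace s \<tau> x" for a x
  proof -
    have "laplace s \<tau> (a *\<^sub>C x) =
        integral {0..\<tau>} (scaleC a \<circ> (\<lambda>t. exp (- (s * of_real t)) *\<^sub>C S t x))"
      unfolding laplace_def
      by (rule integral_cong) (auto simp: S_scaleC scaleC_scaleC mult.commute)
    then show ?thesis
      unfolding laplace_def
      by (subst (asm) integral_linear) (auto intro: weighted_orbit_integrable bounded_linear_scaleC_right)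
  qed
  have "bounded_linear (laplace s \<tau>)"
  proof (rule bounded_linear_intro)
    fix x y :: 'h and r :: real
    have "laplace s \<tau> (x + y) = integral {0..\<tau>} (\<lambda>t. exp (- (s * of_real t)) *\<^sub>C S t x
        + exp (- (s * of_real t)) *\<^sub>C S t y)"
      unfolding laplace_def
      by (rule integral_cong) (use bounded_linear_S in \<open>auto simp: linear_simps scaleC_add_right\<close>)
    then show "laplace s \<tau> (x + y) = laplace s \<tau> x + laplace s \<tau> y"
      unfolding laplace_def by (simp add: integral_add weighted_orbit_integrable)
    show "laplace s \<tau> (r *\<^sub>R x) = r *\<^sub>R laplace s \<tau> x"
      using scale[of "complex_of_real r" x] by (simp add: scaleC_of_real)
    have "norm (laplace s \<tau> x) \<le> exp (cmod s * \<tau>) * (M * norm x) * measure lborel {0..\<tau>}"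
      unfolding laplace_def
    proof (rule has_integral_bound_real)
      show "((\<lambda>t. exp (- (s * of_real t)) *\<^sub>C S t x) has_integral
          integral {0..\<tau>} (\<lambda>t. exp (- (s * of_real t)) *\<^sub>C S t x)) {0..\<tau>}"
        by (intro integrable_integral weighted_orbit_integrable) simp
      fix t assume t: "t \<in> {0..\<tau>} - {}"
      have "cmod (exp (- (s * of_real t))) \<le> exp (cmod s * \<tau>)"
        unfolding norm_exp_eq_Re
      proof (subst exp_le_cancel_iff)
        have "Re (- (s * of_real t)) \<le> cmod (- (s * of_real t))" by (rule complex_Re_le_cmod)
        also have "\<dots> = cmod s * t" using t by (simp add: norm_mult)
        also have "\<dots> \<le> cmod s * \<tau>" using t by (intro mult_left_mono) auto
        finally show "Re (- (s * of_real t)) \<le> cmod s * \<tau>" .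
      qed
      then show "norm (exp (- (s * of_real t)) *\<^sub>C S t x) \<le> exp (cmod s * \<tau>) * (M * norm x)"
        unfolding norm_scaleC using M t by (intro mult_mono) auto
    qed (use M in auto)
    then show "norm (laplace s \<tau> x) \<le> norm x * (exp (cmod s * \<tau>) * M * measure lborel {0..\<tau>})"
      by (simp add: mult_ac)
  qed
  with scale show ?thesis by (simp add: bounded_clinear_def)
qed

lemma bounded_operator_laplace:
  assumes P: "bounded_clinear P"
  shows "P (laplace s \<tau> x) = integral {0..\<tau>} (\<lambda>t. exp (- (s * of_real t)) *\<^sub>C P (S t x))"
proof -
  have "P (laplace s \<tau> x) = integral {0..\<tau>} (P \<circ> (\<lambda>t. exp (- (s * of_real t)) *\<^sub>C S t x))"
    using P unfolding laplace_def bounded_clinear_def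
    by (subst integral_linear) (auto intro: weighted_orbit_integrable)
  then show ?thesis using P by (simp add: o_def bounded_clinear_def)
qed

lemma S_laplace: "t \<ge> 0 \<Longrightarrow> S t (laplace s \<tau> x) = laplace s \<tau> (S t x)"
  unfolding bounded_operator_laplace[OF bounded_clinear_S]
  unfolding laplace_def by (rule integral_cong) (simp add: S_commute)

text \<open>\<open>S h\<close> moves the window of integration to \<open>{h..\<tau> + h}\<close> and
  contributes a factor \<open>exp (s * h)\<close>. The product rule at \<open>h = 0\<close> then
  gives \<open>s\<close> times the integral plus the boundary terms.\<close>

lemma laplace_domain:
  assumes "\<tau> \<ge> 0"
  shows "laplace s \<tau> x \<in> domain A"
    and "app A (laplace s \<tau> x) =
      s *\<^sub>C laplace s \<tau> x + (exp (- (s * of_real \<tau>)) *\<^sub>C S \<tau> x - x)"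
proof -
  define g where "g t = exp (- (s * of_real t)) *\<^sub>C S t x" for t
  define G where "G t = integral {0..t} g" for t
  have g: "continuous_on {0..} g" unfolding g_def by (rule continuous_on_weighted_orbit)
  have int: "g integrable_on {a..b}" if "a \<ge> 0" for a b
    unfolding g_def by (rule weighted_orbit_integrable[OF that])
  \<comment> \<open>The interval extends past \<open>\<tau>\<close> so that \<open>G\<close> can be
    differentiated to the right of \<open>\<tau>\<close> too.\<close>
  have G: "(G has_vector_derivative g t) (at t within {0..\<tau> + 1})" if "t \<in> {0..\<tau> + 1}" for t
    unfolding G_def using that
    by (intro integral_has_vector_derivative continuous_on_subset[OF g]) auto
  have shift: "S h (laplace s \<tau> x) = exp (s * of_real h) *\<^sub>C (G (\<tau> + h) - G h)"
    if "h \<ge> 0" for h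
  proof -
    have "S h (laplace s \<tau> x) = integral {0..\<tau>} (scaleC (exp (s * of_real h)) \<circ> (g \<circ> (+) h))"
      unfolding bounded_operator_laplace[OF bounded_clinear_S[OF that]]
      using that by (intro integral_cong)
        (auto simp: g_def S_add scaleC_scaleC ring_distribs simp flip: exp_add)
    also have "\<dots> = exp (s * of_real h) *\<^sub>C integral {0..\<tau>} (g \<circ> (+) h)"
    proof (rule integral_linear[OF _ bounded_linear_scaleC_right])
      have "continuous_on {0..\<tau>} (g \<circ> (+) h)"
        using that by (intro continuous_on_compose continuous_intros continuous_on_subset[OF g]) auto
      then show "(g \<circ> (+) h) integrable_on {0..\<tau>}" by (rule integrable_continuous_real)
    qed
    also have "integral {0..\<tau>} (g \<circ> (+) h) = integral {h..\<tau> + h} g"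
      by (simp add: integral_shift_Icc_real)
    also have "\<dots> = G (\<tau> + h) - G h"
      using Henstock_Kurzweil_Integration.integral_combine[of 0 h "\<tau> + h" g] int assms that by (simp add: G_def algebra_simps)
    finally show ?thesis .
  qed
  have exp_deriv: "((\<lambda>h. exp (s * complex_of_real h)) has_vector_derivative s) (at 0 within {0..1})"
  proof -
    have "((\<lambda>z. exp (s * z)) has_field_derivative s) (at (complex_of_real 0))"
      by (auto intro!: derivative_eq_intros)
    from has_vector_derivative_real_field[OF this] show ?thesis by simp
  qed
  have G0: "(G has_vector_derivative g 0) (at 0 within {0..1})"
    using assms by (intro has_vector_derivative_within_subset[OF G]) auto
  have G\<tau>: "((\<lambda>h. G (\<tau> + h)) has_vector_derivative g \<tau>) (at 0 within {0..1})"
  proof -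
    have "(G has_vector_derivative g \<tau>) (at \<tau> within (+) \<tau> ` {0..1})"
      using assms by (intro has_vector_derivative_within_subset[OF G]) auto
    moreover have "((+) \<tau> has_vector_derivative 1) (at 0 within {0..1})"
      by (auto intro!: derivative_eq_intros)
    ultimately show ?thesis
      using vector_diff_chain_within[of "(+) \<tau>" 1 0 "{0..1}" G "g \<tau>"] by (simp add: o_def)
  qed
  have "((\<lambda>h. exp (s * complex_of_real h) *\<^sub>C (G (\<tau> + h) - G h)) has_vector_derivative
      exp (s * complex_of_real 0) *\<^sub>C (g \<tau> - g 0) + s *\<^sub>C (G (\<tau> + 0) - G 0)) (at 0 within {0..1})"
    by (rule bounded_bilinear.has_vector_derivative[OF bounded_bilinear_scaleC exp_deriv
          has_vector_derivative_diff[OF G\<tau> G0]])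
  then have deriv: "((\<lambda>h. exp (s * complex_of_real h) *\<^sub>C (G (\<tau> + h) - G h))
      has_vector_derivative (g \<tau> - g 0) + s *\<^sub>C (G \<tau> - G 0)) (at 0 within {0..1})"
    by simp
  have "((\<lambda>h. S h (laplace s \<tau> x)) has_vector_derivative
      (g \<tau> - g 0) + s *\<^sub>C (G \<tau> - G 0)) (at 0 within {0..1})"
    by (rule has_vector_derivative_transform[OF _ _ deriv]) (auto simp: shift)
  from has_vector_derivative_imp_right_quotient_tendsto[OF this]
  have "((\<lambda>h. (S h (laplace s \<tau> x) - laplace s \<tau> x) /\<^sub>R h) \<longlongrightarrow>
      (g \<tau> - g 0) + s *\<^sub>C (G \<tau> - G 0)) (at_right 0)"
    by (simp add: S_0)
  moreover have "(g \<tau> - g 0) + s *\<^sub>C (G \<tau> - G 0) =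
      s *\<^sub>C laplace s \<tau> x + (exp (- (s * of_real \<tau>)) *\<^sub>C S \<tau> x - x)"
    by (simp add: g_def[abs_def] G_def laplace_def S_0)
  ultimately have "((\<lambda>h. (S h (laplace s \<tau> x) - laplace s \<tau> x) /\<^sub>R h) \<longlongrightarrow>
      s *\<^sub>C laplace s \<tau> x + (exp (- (s * of_real \<tau>)) *\<^sub>C S \<tau> x - x)) (at_right 0)"
    by simp
  note domainI[OF this]
  then show "laplace s \<tau> x \<in> domain A"
    and "app A (laplace s \<tau> x) =
      s *\<^sub>C laplace s \<tau> x + (exp (- (s * of_real \<tau>)) *\<^sub>C S \<tau> x - x)"
    by simp_all
qed

end

context generator
begin

section \<open>Eigenvector orbits, density of the domain and the adjoint\<close>

text \<open>\<open>A\<close> commutes with the truncated transform, so the transform of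
  \<open>v\<close> is again mapped to its \<open>s\<close>-multiple. By
  \<open>laplace_domain\<close> the boundary term \<open>exp (- (s * t)) *\<^sub>C S t v - v\<close>
  must vanish.\<close>

lemma eigenvector_orbit:
  assumes v: "v \<in> ker (shift s A)" and t: "t \<ge> 0"
  shows "S t v = exp (s * of_real t) *\<^sub>C v"
proof -
  have Av: "v \<in> domain A" "app A v = s *\<^sub>C v"
    using v by (auto simp: ker_def shift_def)
  note L = bounded_clinear_laplace[OF t, of s, unfolded bounded_clinear_def]
  have "app A (laplace s t v) = laplace s t (app A v)"
    by (rule bounded_operator_commutes(2)[OF conjunct1[OF L] S_laplace[symmetric] Av(1)])
  also have "\<dots> = s *\<^sub>C laplace s t v" using L Av by simp
  finally have "exp (- (s * of_real t)) *\<^sub>C S t v = v"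
    using laplace_domain(2)[OF t, of s v] by simp
  then have "exp (s * of_real t) *\<^sub>C v = exp (s * of_real t) *\<^sub>C exp (- (s * of_real t)) *\<^sub>C S t v"
    by simp
  also have "\<dots> = S t v" by (simp add: scaleC_scaleC flip: exp_add)
  finally show ?thesis by simp
qed

text \<open>The time averages of an orbit over \<open>{0..h}\<close> lie in the domain and tend to
  its starting point.\<close>

lemma domain_dense: "closure (domain A) = UNIV"
proof -
  have "x \<in> closure (domain A)" for x
  proof (rule Lim_in_closed_set[OF closed_closure])
    have "continuous_on {0..1} (\<lambda>t. S t x)"
      by (rule continuous_on_subset[OF orbit_continuous]) auto
    from integral_has_vector_derivative[OF this, of 0]
    have "((\<lambda>h. laplace 0 h x) has_vector_derivative x) (at 0 within {0..1})"
      by (simp add: laplace_def S_0)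
    from has_vector_derivative_imp_right_quotient_tendsto[OF this]
    show "((\<lambda>h. laplace 0 h x /\<^sub>R h) \<longlongrightarrow> x) (at_right 0)"
      by (simp add: laplace_def)
    have "subspace (domain A)"
      using linear_operator_A csubspace_imp_subspace by (auto simp: linear_operator_def)
    then have "laplace 0 h x /\<^sub>R h \<in> closure (domain A)" if "h > 0" for h
      using that laplace_domain(1)[of h 0 x]
      by (intro subsetD[OF closure_subset] subspace_scale) simp_all
    then show "\<forall>\<^sub>F h in at_right 0. laplace 0 h x /\<^sub>R h \<in> closure (domain A)"
      by (auto simp: eventually_at_right_field intro!: exI[of _ 1])
  qed simp
  then show ?thesis by auto
qed

text \<open>Density of the domain gives the uniqueness that the description operator in
  \<open>adjoint_op\<close> relies on.\<close>

lemma cinner_adjoint: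
  assumes y: "y \<in> domain (adjoint_op A)" and x: "x \<in> domain A"
  shows "cinner (app A x) y = cinner x (app (adjoint_op A) y)"
proof -
  have "\<exists>!w. \<forall>x\<in>domain A. cinner (app A x) y = cinner x w"
  proof (rule ex_ex1I)
    show "\<exists>w. \<forall>x\<in>domain A. cinner (app A x) y = cinner x w"
      using y by (simp add: adjoint_op_def)
    fix w w'
    assume "\<forall>x\<in>domain A. cinner (app A x) y = cinner x w"
      "\<forall>x\<in>domain A. cinner (app A x) y = cinner x w'"
    then have "w - w' = 0"
      by (intro orthogonal_to_dense[OF domain_dense]) (simp add: cinner_diff_right)
    then show "w = w'" by simp
  qed
  from theI'[OF this] show ?thesis using x by (simp add: adjoint_op_def)
qed

section \<open>Unobservable subspaces\<close>

text \<open>The observation \<open>P\<close> is a total function, bounded in the lemmas below. The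
  unbounded \<open>C\<close> enters later through
  \<open>P = C (s - A)\<^sup>-\<^sup>1\<close>.\<close>

definition unobservable :: "('h \<Rightarrow> 'u::chilbert_space) \<Rightarrow> 'h set"
  where "unobservable P = {x. \<forall>t\<ge>0. P (S t x) = 0}"

lemma csubspace_unobservable:
  assumes "bounded_clinear P"
  shows "csubspace (unobservable P)"
  using assms bounded_linear_S
  by (auto simp: unobservable_def complex_vector.subspace_def bounded_clinear_def linear_simps S_scaleC)

lemma closed_unobservable:
  assumes P: "bounded_clinear P"
  shows "closed (unobservable P)"
proof -
  have "unobservable P = (\<Inter>t\<in>{0..}. {x. P (S t x) = 0})"
    by (auto simp: unobservable_def)
  moreover have "closed {x. P (S t x) = 0}" if "t \<in> {0..}" for t
  proof -
    have "bounded_linear (\<lambda>x. P (S t x))"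
      using P that bounded_linear_S unfolding bounded_clinear_def
      by (intro bounded_linear_compose[of P "S t"]) auto
    then show ?thesis
      by (intro closed_Collect_eq linear_continuous_on continuous_on_const)
  qed
  ultimately show ?thesis by auto
qed

lemma S_unobservable: "x \<in> unobservable P \<Longrightarrow> t \<ge> 0 \<Longrightarrow> S t x \<in> unobservable P"
  by (simp add: unobservable_def flip: S_add)

text \<open>\<open>P\<close> composed with \<open>S t\<close> is bounded and passes under the
  integral, where the integrand vanishes by the semigroup law.\<close>

lemma laplace_unobservable:
  assumes P: "bounded_clinear P" and x: "x \<in> unobservable P"
  shows "laplace s \<tau> x \<in> unobservable P"
  unfolding unobservable_def
proof (intro CollectI allI impI)
  fix t :: real assume t: "t \<ge> 0"
  have "P (S t (laplace s \<tau> x)) = integral {0..\<tau>} (\<lambda>r. exp (- (s * of_real r)) *\<^sub>C P (S t (S r x)))"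
    using bounded_operator_laplace[OF bounded_clinear_compose[OF P bounded_clinear_S[OF t]]] .
  also have "\<dots> = integral {0..\<tau>} (\<lambda>r. 0)"
    using x t by (intro integral_cong) (simp add: unobservable_def flip: S_add)
  finally show "P (S t (laplace s \<tau> x)) = 0" by simp
qed

lemma ex_contractive_weight:
  "\<exists>s. \<forall>x. norm (exp (- (s * of_real 1)) *\<^sub>C S 1 x) \<le> norm x / 2"
proof -
  obtain M where M: "M > 0" "\<And>x. norm (S 1 x) \<le> M * norm x"
    using S_locally_bounded[of 1] by (meson atLeastAtMost_iff order_refl zero_le_one)
  \<comment> \<open>The choice \<open>s = ln (2 * M)\<close> gives the weight modulus
    \<open>1 / (2 * M)\<close>, which turns the bound \<open>M\<close> into
    \<open>1/2\<close>.\<close>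
  have "norm (exp (- (complex_of_real (ln (2 * M)) * of_real 1)) *\<^sub>C S 1 x) \<le> norm x / 2" for x
  proof -
    have weight: "cmod (exp (- (complex_of_real (ln (2 * M)) * of_real 1))) = 1 / (2 * M)"
      unfolding norm_exp_eq_Re using M(1) by (simp add: exp_minus inverse_eq_divide)
    show ?thesis using M(2)[of x] M(1) unfolding norm_scaleC weight by (simp add: field_simps)
  qed
  then show ?thesis by blast
qed

end

section \<open>A distinguished resolvent and unobservable subspaces\<close>

text \<open>A concrete point of the resolvent set that is reached without an improper Laplace integral:
  if \<open>Q = e\<^sup>-\<^sup>s\<^sup>\<tau> S \<tau>\<close> is a strict contraction, then \<open>(s - A)\<^sup>-\<^sup>1\<close> is the truncated Laplace
  transform composed with \<open>(id - Q)\<^sup>-\<^sup>1\<close>, and both preserve unobservable subspaces.\<close>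

locale contractive_weight = generator A S
  for A :: "('h::chilbert_space, 'h) operator" and S :: "real \<Rightarrow> 'h \<Rightarrow> 'h" +
  fixes s :: complex and \<tau> :: real
  assumes tau_nonneg: "\<tau> \<ge> 0"
    and contraction: "norm (exp (- (s * of_real \<tau>)) *\<^sub>C S \<tau> x) \<le> norm x / 2"
begin

section \<open>The resolvent at the distinguished point\<close>

text \<open>Banach's fixed point theorem for \<open>y \<mapsto> x + Q y\<close> on the closed
  invariant subspace replaces the Neumann series; the factor 2 comes from
  \<open>norm y \<le> norm x + norm y / 2\<close>.\<close>

lemma solve_in_unobservable:
  fixes P :: "'h \<Rightarrow> 'u::chilbert_space"
  assumes P: "bounded_clinear P" and x: "x \<in> unobservable P"
  shows "\<exists>y\<in>unobservable P. y - exp (- (s * of_real \<tau>)) *\<^sub>C S \<tau> y = x \<and> norm y \<le> 2 * norm x"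
proof -
  let ?N = "unobservable P" and ?Q = "\<lambda>y. exp (- (s * of_real \<tau>)) *\<^sub>C S \<tau> y"
  note N = csubspace_unobservable[OF P]
  have "\<exists>!y. y \<in> ?N \<and> x + ?Q y = y"
  proof (rule Banach_fix)
    show "complete ?N" using closed_unobservable[OF P] by (simp add: complete_eq_closed)
    show "?N \<noteq> {}" using x by auto
    show "(\<lambda>y. x + ?Q y) ` ?N \<subseteq> ?N"
      using x S_unobservable[OF _ tau_nonneg]
      by (auto intro!: complex_vector.subspace_add[OF N] complex_vector.subspace_scale[OF N])
    show "dist (x + ?Q y) (x + ?Q z) \<le> (1/2) * dist y z" if "y \<in> ?N" "z \<in> ?N" for y z
    proof -
      have "?Q y - ?Q z = ?Q (y - z)"
        using bounded_linear_S[OF tau_nonneg]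
        by (simp add: linear_simps complex_vector.scale_right_diff_distrib)
      then show ?thesis using contraction[of "y - z"] by (simp add: dist_norm)
    qed
  qed auto
  then obtain y where y: "y \<in> ?N" "x + ?Q y = y" by auto
  then have "norm y \<le> norm x + norm y / 2"
    using norm_triangle_ineq[of x "?Q y"] contraction[of y] by simp
  with y show ?thesis by (intro bexI[of _ y]) (auto simp: algebra_simps)
qed

lemma shift_laplace:
  "s *\<^sub>C laplace s \<tau> y - app A (laplace s \<tau> y) = y - exp (- (s * of_real \<tau>)) *\<^sub>C S \<tau> y"
  by (simp add: laplace_domain(2)[OF tau_nonneg])

text \<open>A vector in the kernel of \<open>s - A\<close> evolves by the factor
  \<open>exp (s * t)\<close>, so it is fixed by the contraction \<open>Q\<close> and must be
  0.\<close>

lemma shift_injective: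
  assumes "v \<in> domain A" "w \<in> domain A" "s *\<^sub>C v - app A v = s *\<^sub>C w - app A w"
  shows "v = w"
proof -
  define u where "u = v + (-1) *\<^sub>C w"
  note w = A_scaleC[OF assms(2), of "-1"]
  have u: "u \<in> domain A" "app A u = app A v + (-1) *\<^sub>C app A w"
    unfolding u_def w(2)[symmetric] by (fact A_add[OF assms(1) w(1)])+
  have "s *\<^sub>C u - app A u = (s *\<^sub>C v - app A v) - (s *\<^sub>C w - app A w)"
    unfolding u(2) by (simp add: u_def complex_vector.scale_right_diff_distrib)
  then have "u \<in> ker (shift s A)" using u assms(3) by (simp add: ker_def shift_def)
  then have "S \<tau> u = exp (s * of_real \<tau>) *\<^sub>C u" using tau_nonneg by (rule eigenvector_orbit)
  then have "exp (- (s * of_real \<tau>)) *\<^sub>C S \<tau> u = u"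
    by (simp add: scaleC_scaleC flip: exp_add)
  then have "u = 0" using contraction[of u] by simp
  then show ?thesis by (simp add: u_def)
qed

lemma resolvent_left:
  assumes "v \<in> domain A"
  shows "resolvent A s (s *\<^sub>C v - app A v) = v"
proof -
  have "inj_on (app (shift s A)) (domain A)"
    using shift_injective by (auto simp: inj_on_def shift_def)
  from inv_into_f_f[OF this assms] show ?thesis by (simp add: resolvent_def shift_def)
qed

lemma resolvent_in_unobservable:
  fixes P :: "'h \<Rightarrow> 'u::chilbert_space"
  assumes P: "bounded_clinear P" and x: "x \<in> unobservable P"
  shows "\<exists>y\<in>unobservable P. resolvent A s x = laplace s \<tau> y \<and> norm y \<le> 2 * norm x"
proof -
  obtain y where y: "y \<in> unobservable P" "y - exp (- (s * of_real \<tau>)) *\<^sub>C S \<tau> y = x" "norm y \<le> 2 * norm x"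
    using solve_in_unobservable[OF P x] by blast
  then have "resolvent A s x = laplace s \<tau> y"
    using resolvent_left[OF laplace_domain(1)[OF tau_nonneg]] shift_laplace[of y] by metis
  with y show ?thesis by blast
qed

lemma resolvent_unobservable:
  assumes "bounded_clinear P" "x \<in> unobservable P"
  shows "resolvent A s x \<in> unobservable P"
  using resolvent_in_unobservable[OF assms] laplace_unobservable[OF assms(1)] by metis

text \<open>For the zero observation every vector is unobservable, so the results on unobservable
  subspaces specialise to the whole space.\<close>

lemma bounded_clinear_zero: "bounded_clinear (\<lambda>x::'h. 0::complex)"
  by (simp add: bounded_clinear_def scaleC_complex_def)

lemma resolvent_eq_laplace: "\<exists>y. resolvent A s x = laplace s \<tau> y \<and> norm y \<le> 2 * norm x"
  using resolvent_in_unobservable[OF bounded_clinear_zero] by (auto simp: unobservable_def)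

lemma resolvent_domain: "resolvent A s x \<in> domain A"
  using resolvent_eq_laplace[of x] laplace_domain(1)[OF tau_nonneg] by metis

lemma resolvent_right: "s *\<^sub>C resolvent A s x - app A (resolvent A s x) = x"
proof -
  obtain y where y: "y - exp (- (s * of_real \<tau>)) *\<^sub>C S \<tau> y = x"
    using solve_in_unobservable[OF bounded_clinear_zero, of x] by (auto simp: unobservable_def)
  then have "resolvent A s x = laplace s \<tau> y"
    using resolvent_left[OF laplace_domain(1)[OF tau_nonneg]] shift_laplace[of y] by metis
  then show ?thesis using shift_laplace[of y] y by simp
qed

lemma resolvent_eqI:
  "v \<in> domain A \<Longrightarrow> s *\<^sub>C v - app A v = x \<Longrightarrow> resolvent A s x = v"
  using resolvent_left by blast

text \<open>Linearity follows from uniqueness of solutions of \<open>(s - A) v = x\<close>,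
  boundedness from that of the truncated transform and of
  \<open>(id - Q)\<^sup>-\<^sup>1\<close>.\<close>

lemma bounded_clinear_resolvent: "bounded_clinear (resolvent A s)"
proof -
  have scale: "resolvent A s (a *\<^sub>C x) = a *\<^sub>C resolvent A s x" for a x
  proof (rule resolvent_eqI)
    show "s *\<^sub>C a *\<^sub>C resolvent A s x - app A (a *\<^sub>C resolvent A s x) = a *\<^sub>C x"
      using arg_cong[OF resolvent_right[of x], of "scaleC a"]
      by (simp add: A_scaleC resolvent_domain complex_vector.scale_right_diff_distrib
          scaleC_scaleC mult.commute)
  qed (simp add: A_scaleC resolvent_domain)
  obtain K where K: "K > 0" "\<And>y. norm (laplace s \<tau> y) \<le> norm y * K"
    using bounded_linear.pos_bounded bounded_clinear_laplace[OF tau_nonneg]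
    unfolding bounded_clinear_def by metis
  have "bounded_linear (resolvent A s)"
  proof (rule bounded_linear_intro)
    fix x y :: 'h and r :: real
    show "resolvent A s (x + y) = resolvent A s x + resolvent A s y"
    proof (rule resolvent_eqI)
      show "s *\<^sub>C (resolvent A s x + resolvent A s y) - app A (resolvent A s x + resolvent A s y) = x + y"
        using resolvent_right[of x] resolvent_right[of y]
        by (simp add: A_add resolvent_domain scaleC_add_right algebra_simps)
    qed (simp add: A_add resolvent_domain)
    show "resolvent A s (r *\<^sub>R x) = r *\<^sub>R resolvent A s x"
      using scale[of "complex_of_real r" x] by (simp add: scaleC_of_real)
    obtain y where y: "resolvent A s x = laplace s \<tau> y" "norm y \<le> 2 * norm x"
      using resolvent_eq_laplace by blast
    have "norm (resolvent A s x) \<le> norm y * K" using y K by simp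
    also have "\<dots> \<le> (2 * norm x) * K" using y K by (intro mult_right_mono) auto
    finally show "norm (resolvent A s x) \<le> norm x * (2 * K)" by simp
  qed
  with scale show ?thesis by (simp add: bounded_clinear_def)
qed

lemma S_resolvent: "t \<ge> 0 \<Longrightarrow> resolvent A s (S t x) = S t (resolvent A s x)"
proof (rule resolvent_eqI)
  assume t: "t \<ge> 0"
  note comm = bounded_operator_commutes[OF bounded_linear_S[OF t] S_commute[OF t] resolvent_domain]
  show "S t (resolvent A s x) \<in> domain A" using comm(1) by simp
  have "s *\<^sub>C S t (resolvent A s x) - app A (S t (resolvent A s x)) =
      S t (s *\<^sub>C resolvent A s x - app A (resolvent A s x))"
    using comm(2) bounded_linear_S[OF t] t by (simp add: linear_simps S_scaleC)
  then show "s *\<^sub>C S t (resolvent A s x) - app A (S t (resolvent A s x)) = S t x"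
    by (simp add: resolvent_right)
qed

section \<open>Compactness, root vectors and the observation\<close>

text \<open>Compactness is given at some point \<open>\<mu>\<close>, possibly different from
  \<open>s\<close>; the resolvent identity in \<open>eq\<close> transfers it.\<close>

lemma resolvent_convergent_subsequence:
  assumes "has_compact_resolvent A" "bounded (range x)"
  shows "\<exists>l r. strict_mono (r :: nat \<Rightarrow> nat) \<and> (\<lambda>n. resolvent A s (x (r n))) \<longlonglongrightarrow> l"
proof -
  obtain \<mu> where \<mu>: "\<mu> \<in> resolvent_set A" "compact_operator (resolvent A \<mu>)"
    using assms by (auto simp: has_compact_resolvent_def)
  have eq: "resolvent A s y = resolvent A \<mu> (y + (\<mu> - s) *\<^sub>C resolvent A s y)" for y
  proof -
    have "app (shift \<mu> A) (resolvent A s y) = y + (\<mu> - s) *\<^sub>C resolvent A s y"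
      using resolvent_right[of y]
      by (simp add: shift_def complex_vector.scale_left_diff_distrib algebra_simps)
    then show ?thesis
      using \<mu>(1) inv_into_f_f[OF bij_betw_imp_inj_on resolvent_domain, of "app (shift \<mu> A)" UNIV y]
      by (simp add: resolvent_set_def resolvent_def)
  qed
  have "bounded_linear (\<lambda>y. y + (\<mu> - s) *\<^sub>C resolvent A s y)"
    using bounded_clinear_resolvent unfolding bounded_clinear_def
    by (intro bounded_linear_add bounded_linear_ident
        bounded_linear_compose[OF bounded_linear_scaleC_right]) auto
  from bounded_linear_image[OF assms(2) this]
  have "bounded (range (\<lambda>n. x n + (\<mu> - s) *\<^sub>C resolvent A s (x n)))"
    by (simp add: image_image)
  from compact_operator_convergent_subsequence[OF \<mu>(2) this] show ?thesis
    unfolding eq[symmetric] by blast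
qed

text \<open>By the Fredholm alternative \<open>cnj \<mu> - A\<close> maps the unobservable states in \<open>domain A\<close> onto
  all unobservable states, so \<open>w\<close> is orthogonal to them as soon as \<open>(\<mu> - A*) w\<close> is.\<close>

lemma root_vector_orthogonal_to_unobservable:
  fixes P :: "'h \<Rightarrow> 'u::chilbert_space"
  assumes compact: "has_compact_resolvent A" and P: "bounded_clinear P"
    and no_eigenvector: "\<And>\<mu> v. v \<in> ker (shift \<mu> A) \<Longrightarrow> v \<in> unobservable P \<Longrightarrow> v = 0"
    and w: "w \<in> ker (op_power (shift \<mu> (adjoint_op A)) k)" and z: "z \<in> unobservable P"
  shows "cinner z w = 0"
  using w z
proof (induction k arbitrary: w z)
  case 0
  \<comment> \<open>The zeroth power is the identity, so \<open>w = 0\<close>.\<close>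
  then show ?case by (simp add: ker_def)
next
  case (Suc k)
  let ?N = "unobservable P" and ?R = "resolvent A s"
  define w' where "w' = \<mu> *\<^sub>C w - app (adjoint_op A) w"
  have w: "w \<in> domain (adjoint_op A)" "w' \<in> ker (op_power (shift \<mu> (adjoint_op A)) k)"
    using Suc.prems(1) unfolding op_power_Suc_right
    by (auto simp: ker_def op_comp_def shift_def w'_def)
  \<comment> \<open>Since \<open>x = (s - A) (?R x)\<close>, this factor makes
    \<open>x - K x\<close> equal to \<open>(cnj \<mu> - A) (?R x)\<close>.\<close>
  define K where "K x = (s - cnj \<mu>) *\<^sub>C ?R x" for x
  have "bounded_linear K"
    using bounded_clinear_resolvent bounded_linear_compose[OF bounded_linear_scaleC_right]
    unfolding K_def bounded_clinear_def by blast
  have "(\<lambda>x. x - K x) ` ?N = ?N"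
  proof (rule Fredholm_alternative_on_closed_subspace)
    show "bounded_linear K" by fact
    show "subspace ?N" using csubspace_unobservable[OF P] by (rule csubspace_imp_subspace)
    show "closed ?N" using P by (rule closed_unobservable)
    show "K ` ?N \<subseteq> ?N"
      using csubspace_unobservable[OF P] resolvent_unobservable[OF P]
      by (auto simp: K_def intro: complex_vector.subspace_scale)
    show "\<exists>l r. strict_mono r \<and> (\<lambda>n. K (x (r n))) \<longlonglongrightarrow> l"
      if "bounded (range x)" for x :: "nat \<Rightarrow> 'h"
    proof -
      obtain l r where "strict_mono r" "(\<lambda>n. ?R (x (r n))) \<longlonglongrightarrow> l"
        using resolvent_convergent_subsequence[OF compact \<open>bounded (range x)\<close>] by blast
      then show ?thesis
        using bounded_linear.tendsto[OF bounded_linear_scaleC_right] unfolding K_def by blast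
    qed
    fix x assume x: "x \<in> ?N" "K x = x"
    \<comment> \<open>A fixed point \<open>x\<close> of \<open>K\<close> would make
      \<open>?R x\<close> an unobservable eigenvector of \<open>A\<close>; hence
      \<open>?R x = 0\<close>, and \<open>x\<close> is a multiple of it.\<close>
    have "cnj \<mu> *\<^sub>C ?R x - app A (?R x) = 0"
      using x(2) resolvent_right[of x]
      by (simp add: K_def complex_vector.scale_left_diff_distrib algebra_simps)
    then have "?R x \<in> ker (shift (cnj \<mu>) A)"
      using resolvent_domain by (simp add: ker_def shift_def)
    then have "?R x = 0" using no_eigenvector resolvent_unobservable[OF P x(1)] by blast
    then show "x = 0" using x(2) by (simp add: K_def)
  qed
  then obtain x where x: "x \<in> ?N" "z = x - K x" using Suc.prems(2) by blast
  have "z = cnj \<mu> *\<^sub>C ?R x - app A (?R x)"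
    using resolvent_right[of x]
    by (simp add: x(2) K_def complex_vector.scale_left_diff_distrib algebra_simps)
  \<comment> \<open>Antilinearity in the second argument turns \<open>cnj \<mu>\<close> into
    \<open>\<mu>\<close> as the operator moves to the adjoint side.\<close>
  then have "cinner z w = cinner (?R x) w'"
    using cinner_adjoint[OF w(1) resolvent_domain]
    by (simp add: w'_def cinner_diff_left cinner_diff_right cinner_scaleC_left cinner_scaleC_right)
  then show ?case using Suc.IH[OF w(2) resolvent_unobservable[OF P x(1)]] by simp
qed

text \<open>Relative boundedness controls \<open>C\<close> by the graph norm of \<open>A\<close>,
  and \<open>A (s - A)\<^sup>-\<^sup>1 x = s (s - A)\<^sup>-\<^sup>1 x - x\<close> bounds that norm
  on resolvent values.\<close>

lemma bounded_clinear_observation: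
  fixes C :: "('h, 'u::chilbert_space) operator"
  assumes C: "linear_operator C" "relatively_bounded C A"
  shows "bounded_clinear (\<lambda>x. app C (resolvent A s x))"
proof -
  note R = bounded_clinear_resolvent[unfolded bounded_clinear_def]
  obtain c where c: "c \<ge> 0" "domain A \<subseteq> domain C"
      "\<And>z. z \<in> domain A \<Longrightarrow> norm (app C z) \<le> c * (norm z + norm (app A z))"
    using C(2) by (auto simp: relatively_bounded_def)
  have dom: "resolvent A s x \<in> domain C" for x using resolvent_domain c(2) by blast
  obtain K where K: "K > 0" "\<And>x. norm (resolvent A s x) \<le> norm x * K"
    using bounded_linear.pos_bounded R by metis
  have scale: "app C (resolvent A s (a *\<^sub>C x)) = a *\<^sub>C app C (resolvent A s x)" for a x
    using C(1) R dom by (auto simp: linear_operator_def)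
  have "bounded_linear (\<lambda>x. app C (resolvent A s x))"
  proof (rule bounded_linear_intro)
    fix x y :: 'h and r :: real
    show "app C (resolvent A s (x + y)) = app C (resolvent A s x) + app C (resolvent A s y)"
      using C(1) R dom by (simp add: linear_operator_def linear_simps)
    show "app C (resolvent A s (r *\<^sub>R x)) = r *\<^sub>R app C (resolvent A s x)"
      using scale[of "complex_of_real r" x] by (simp add: scaleC_of_real)
    have "app A (resolvent A s x) = s *\<^sub>C resolvent A s x - x"
      using resolvent_right[of x] by (simp add: algebra_simps)
    then have "norm (app A (resolvent A s x)) \<le> cmod s * norm (resolvent A s x) + norm x"
      using norm_triangle_ineq4[of "s *\<^sub>C resolvent A s x" x] by (simp add: norm_scaleC)
    also have "\<dots> \<le> cmod s * (norm x * K) + norm x"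
      using K by (intro add_right_mono mult_left_mono) auto
    finally have "norm (resolvent A s x) + norm (app A (resolvent A s x))
        \<le> norm x * K + (cmod s * (norm x * K) + norm x)"
      using K(2)[of x] by linarith
    then have "c * (norm (resolvent A s x) + norm (app A (resolvent A s x)))
        \<le> c * (norm x * K + (cmod s * (norm x * K) + norm x))"
      using c(1) by (rule mult_left_mono)
    with c(3)[OF resolvent_domain, of x]
    show "norm (app C (resolvent A s x)) \<le> norm x * (c * (K + cmod s * K + 1))"
      by (simp add: algebra_simps)
  qed
  with scale show ?thesis by (simp add: bounded_clinear_def)
qed

end

section \<open>Equivalence of observability and the kernel condition\<close>

theorem theorem1p1:
  fixes A :: "('h::chilbert_space, 'h) operator"
    and C :: "('h, 'u::chilbert_space) operator"
    and S :: "real \<Rightarrow> 'h \<Rightarrow> 'h"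
  assumes "generates A S"
    and "has_compact_resolvent A"
    and "complete_system (root_vectors (adjoint_op A))"
    and "linear_operator C"
    and "relatively_bounded C A"
  shows "(\<forall>z\<in>domain A. (AE t\<in>{0<..} in lebesgue. app C (S t z) = 0) \<longrightarrow> z = 0)
    \<longleftrightarrow> (\<forall>s. ker (shift s A) \<inter> ker C = {0})"
proof -
  interpret generator A S using assms(1) by unfold_locales
  obtain s where s: "\<And>x. norm (exp (- (s * of_real 1)) *\<^sub>C S 1 x) \<le> norm x / 2"
    using ex_contractive_weight by blast
  interpret contractive_weight A S s 1 by unfold_locales (use s in auto)
  define P where "P x = app C (resolvent A s x)" for x
  have P: "bounded_clinear P"
    unfolding P_def by (rule bounded_clinear_observation[OF assms(4,5)])
  have dom: "domain A \<subseteq> domain C" using assms(5) by (simp add: relatively_bounded_def)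
  show ?thesis
  proof (intro iffI allI ballI impI)
    fix r assume obs: "\<forall>z\<in>domain A. (AE t\<in>{0<..} in lebesgue. app C (S t z) = 0) \<longrightarrow> z = 0"
    \<comment> \<open>The orbit of an eigenvector stays on its complex line, so an eigenvector in
      the kernel of \<open>C\<close> is never observed.\<close>
    have "v = 0" if v: "v \<in> ker (shift r A)" "v \<in> ker C" for v
    proof -
      have "app C (S t v) = 0" if "t > 0" for t
        using eigenvector_orbit[OF v(1)] that v(2) assms(4)
        by (simp add: ker_def linear_operator_def)
      then show ?thesis using obs v(1) by (auto simp: ker_def shift_def)
    qed
    moreover have "0 \<in> ker (shift r A)" "0 \<in> ker C"
    proof -
      have "app T 0 = 0 \<and> 0 \<in> domain T" if "linear_operator T" for T :: "('h, 'k::chilbert_space) operator"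
        using that complex_vector.subspace_0 unfolding linear_operator_def
        by (metis complex_vector.scale_zero_left)
      then show "0 \<in> ker (shift r A)" "0 \<in> ker C"
        using linear_operator_A assms(4) by (auto simp: ker_def shift_def)
    qed
    ultimately show "ker (shift r A) \<inter> ker C = {0}" by blast
  next
    fix z
    assume ker: "\<forall>r. ker (shift r A) \<inter> ker C = {0}" and z: "z \<in> domain A"
      and ae: "AE t\<in>{0<..} in lebesgue. app C (S t z) = 0"
    \<comment> \<open>Passing from \<open>z\<close> to \<open>y\<close> replaces \<open>C\<close> by
      the bounded \<open>P\<close>, which makes the observation continuous in time.\<close>
    define y where "y = s *\<^sub>C z - app A z"
    have P_y: "P (S t y) = app C (S t z)" if "t \<ge> 0" for t
      using that resolvent_left[OF z] by (simp add: P_def y_def S_resolvent)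
    \<comment> \<open>A closed set containing almost every point of an open set contains all of it.
      This upgrades "almost every" to every positive time, and taking the closure adds
      \<open>t = 0\<close>.\<close>
    define Z where "Z = {t \<in> {0..}. P (S t y) = 0}"
    have "continuous_on {0..} (\<lambda>t. P (S t y))"
      using P unfolding bounded_clinear_def
      by (intro bounded_linear.continuous_on[OF _ orbit_continuous]) simp
    then have Z: "closed Z" unfolding Z_def by (rule continuous_closed_preimage_constant) simp
    have "AE t\<in>{0<..} in lebesgue. t \<in> Z"
      using ae by eventually_elim (auto simp: Z_def P_y)
    then have "{0<..} \<subseteq> Z"
      using mem_closed_if_AE_lebesgue_open[OF open_greaterThan Z] by blast
    then have "{0..} \<subseteq> Z" using closure_minimal[OF _ Z, of "{0<..}"] by simp
    then have y: "y \<in> unobservable P" by (auto simp: unobservable_def Z_def)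
    have no_eigenvector: "v = 0" if v: "v \<in> ker (shift \<mu> A)" "v \<in> unobservable P" for \<mu> v
    proof -
      have v_dom: "v \<in> domain A" and Av: "app A v = \<mu> *\<^sub>C v"
        using v(1) by (auto simp: ker_def shift_def)
      \<comment> \<open>As \<open>(s - A) v = (s - \<mu>) v\<close>, the vector \<open>C v\<close>
        is a multiple of \<open>P v\<close>, the observation at time 0. No division occurs, so
        \<open>\<mu> = s\<close> is covered.\<close>
      have "app C v = P ((s - \<mu>) *\<^sub>C v)"
        using resolvent_left[OF v_dom]
        by (simp add: P_def Av complex_vector.scale_left_diff_distrib)
      also have "\<dots> = (s - \<mu>) *\<^sub>C P v" using P by (simp add: bounded_clinear_def)
      also have "P v = 0" using v(2) S_0[of v] by (auto simp: unobservable_def)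
      finally have "v \<in> ker C" using v_dom dom by (auto simp: ker_def)
      then show "v = 0" using ker v(1) by blast
    qed
    have orth: "cinner w y = 0" if w: "w \<in> root_vectors (adjoint_op A)" for w
    proof -
      obtain \<mu> k where "w \<in> ker (op_power (shift \<mu> (adjoint_op A)) k)"
        using w unfolding root_vectors_def by blast
      from root_vector_orthogonal_to_unobservable[OF assms(2) P no_eigenvector this y]
      have "cinner y w = 0" .
      then show ?thesis by (subst cinner_commute) simp
    qed
    \<comment> \<open>Orthogonality to the root vectors extends to their span by linearity in the
      first argument, and the span is dense.\<close>
    have "y = 0"
    proof (rule orthogonal_to_dense)
      show "closure (cspan (root_vectors (adjoint_op A))) = UNIV"
        using assms(3) by (simp add: complete_system_def)
      fix u assume "u \<in> cspan (root_vectors (adjoint_op A))"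
      then show "cinner u y = 0"
      proof (induction rule: complex_vector.span_induct_alt)
        case base
        show ?case using cinner_scaleC_left[of 0 0 y] by simp
      next
        case (step a w u)
        then show ?case by (simp add: cinner_add_left cinner_scaleC_left orth)
      qed
    qed
    then show "z = 0"
      using resolvent_left[OF z] bounded_clinear_resolvent
      by (simp add: y_def bounded_clinear_def linear_simps)
  qed
qed

end
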